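(* Suppose that $\boldsymbol{B}^{(p)}\boldsymbol{\Sigma}_2$ has full column rank, and that $$\gamma>\max_{j=1,\ldots,l-1}\left\{\|\boldsymbol{l}^{(1)}_j\|_2+\sqrt{c}\,\|\boldsymbol{l}^{(2)}_j\|_2\right\}\sqrt{\|\boldsymbol{z}_1\|_2^2+c\|\boldsymbol{z}_2\|_2^2},$$ where $\boldsymbol{l}^{(1)}_j$ and $\boldsymbol{l}^{(2)}_j$ denote the $j$-th columns of $\boldsymbol{L}_1$ and $\boldsymbol{L}_2$, respectively. Let $\boldsymbol{\beta}^*\in\mathbb{R}^{l-1}$ be a local minimum of $$F(\boldsymbol{\beta})=\tfrac{1}{2}\|\boldsymbol{z}_1-\boldsymbol{L}_1\boldsymbol{\beta}\|_2^2+\tfrac{c}{2}\|\boldsymbol{z}_2-\boldsymbol{L}_2\boldsymbol{\beta}\|_2^2+\gamma T_K(\boldsymbol{\beta})$$ over $\mathbb{R}^{l-1}$. Then $\|\boldsymbol{\beta}^*\|_0\le K$; consequently, $\boldsymbol{\alpha}^*=\boldsymbol{\Sigma}^{(p+1)}\begin{pmatrix}\boldsymbol{\beta}^*\\ g(\boldsymbol{\beta}^* )\end{pmatrix}$ is a local minimum over $\boldsymbol{\alpha}\in\mathbb{R}^{l+p}$ of $$\tfrac12\|\boldsymbol{y}-\boldsymbol{B}^{(p)}\boldsymbol{\alpha}\|_2^2+\tfrac{c}{2}\|\boldsymbol{D}\boldsymbol{\alpha}\|_2^2+\gamma T_K(\boldsymbol{D}^{(p+1)}\boldsymbol{\alpha})$$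 and satisfies the constraint $\|\boldsymbol{D}^{(p+1)}\boldsymbol{\alpha}^*\|_0\le K$.
   Context: Setting. Let $p\ge0$, $l\ge2$, $n\ge1$ be integers, $t_{-p}<t_{-p+1}<\cdots<t_{l+p}$ real knots, $(x_i,y_i)\in\mathbb{R}^2$, $i=1,\dots,n$, data with $x_i\in[t_0,t_l)$, $\boldsymbol{y}=(y_1,\dots,y_n)^\top$, $c\ge0$, $\gamma>0$, and $K\in\{0,\dots,l-1\}$. B-spline basis functions: $B^{(0)}_j(x)=1$ if $t_j\le x<t_{j+1}$ and $0$ otherwise, $j=-p,\dots,l+p-1$; for $q=1,\dots,p$ and $j=-p,\dots,l+p-q-1$, $$B^{(q)}_{j}(x)=\frac{x-t_{j}}{t_{j+q}-t_{j}}B^{(q-1)}_{j}(x)+\frac{t_{j+q+1}-x}{t_{j+q+1}-t_{j+1}}B^{(q-1)}_{j+1}(x).$$ $\boldsymbol{B}^{(p)}$ is the $n\times(l+p)$ matrix whose $i$-th row is $(B^{(p)}_{-p}(x_i),\dots,B^{(p)}_{l-1}(x_i))$. $\boldsymbol{D}$ is a fixed (ordinary) difference matrix with $l+p$ columns, of arbitrary order $m$ with $1\le m\le l+p-1$: $\boldsymbol{D}\boldsymbol{\alpha}$ is the vector of $m$-th order differences of consecutive entries of $\boldsymbol{\alpha}$. Scaled difference matrices: $\boldsymbol{D}^{(1)}\in\mathbb{R}^{(l-1)\times l}$ has $(i,i)$ entry $-1$, $(i,i+1)$ entry $1$, other entries $0$. For $1\le q\le p$, $\boldsymbol{\Delta}^{(q+1)}\in\mathbb{R}^{(l-1+q)\times(l+q)}$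 has $r$-th row with entry $-\frac{1}{t_r-t_{r-q}}$ in column $r$, entry $\frac{1}{t_r-t_{r-q}}$ in column $r+1$, zeros elsewhere; $\boldsymbol{D}^{(q+1)}=\boldsymbol{D}^{(q)}\boldsymbol{\Delta}^{(q+1)}$. The matrix $\boldsymbol{D}^{(p+1)}\in\mathbb{R}^{(l-1)\times(l+p)}$ has rank $l-1$. Change of variables: $\boldsymbol{A}\in\mathbb{R}^{(p+1)\times(l+p)}$ is a fixed matrix such that $\hat{\boldsymbol{D}}^{(p+1)}=\begin{pmatrix}\boldsymbol{D}^{(p+1)}\\ \boldsymbol{A}\end{pmatrix}\in\mathbb{R}^{(l+p)\times(l+p)}$ is nonsingular; $\boldsymbol{\Sigma}^{(p+1)}=(\hat{\boldsymbol{D}}^{(p+1)})^{-1}=(\boldsymbol{\Sigma}_1\ \boldsymbol{\Sigma}_2)$ with $\boldsymbol{\Sigma}_1\in\mathbb{R}^{(l+p)\times(l-1)}$, $\boldsymbol{\Sigma}_2\in\mathbb{R}^{(l+p)\times(p+1)}$. When $\boldsymbol{B}^{(p)}\boldsymbol{\Sigma}_2$ has full column rank, put $\boldsymbol{M}=(\boldsymbol{B}^{(p)}\boldsymbol{\Sigma}_2)^\top\boldsymbol{B}^{(p)}\boldsymbol{\Sigma}_2+c(\boldsymbol{D}\boldsymbol{\Sigma}_2)^\top\boldsymbol{D}\boldsymbol{\Sigma}_2$ (invertible), and $$\boldsymbol{H}_1=\boldsymbol{M}^{-1}(\boldsymbol{B}^{(p)}\boldsymbol{\Sigma}_2)^\top,\qquad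 \boldsymbol{H}_2=\boldsymbol{M}^{-1}\{(\boldsymbol{B}^{(p)}\boldsymbol{\Sigma}_2)^\top\boldsymbol{B}^{(p)}\boldsymbol{\Sigma}_1+c(\boldsymbol{D}\boldsymbol{\Sigma}_2)^\top\boldsymbol{D}\boldsymbol{\Sigma}_1\},$$ $$\boldsymbol{z}_1=\boldsymbol{y}-\boldsymbol{B}^{(p)}\boldsymbol{\Sigma}_2\boldsymbol{H}_1\boldsymbol{y},\quad \boldsymbol{z}_2=\boldsymbol{D}\boldsymbol{\Sigma}_2\boldsymbol{H}_1\boldsymbol{y},\quad \boldsymbol{L}_1=\boldsymbol{B}^{(p)}\boldsymbol{\Sigma}_1-\boldsymbol{B}^{(p)}\boldsymbol{\Sigma}_2\boldsymbol{H}_2,\quad \boldsymbol{L}_2=\boldsymbol{D}\boldsymbol{\Sigma}_2\boldsymbol{H}_2-\boldsymbol{D}\boldsymbol{\Sigma}_1,$$ and $g(\boldsymbol{\beta})=\boldsymbol{H}_1\boldsymbol{y}-\boldsymbol{H}_2\boldsymbol{\beta}\in\mathbb{R}^{p+1}$, which is the unique minimizer over $\boldsymbol{\beta}'\in\mathbb{R}^{p+1}$ of $$G(\boldsymbol{\beta},\boldsymbol{\beta}')=\tfrac12\|\boldsymbol{y}-\boldsymbol{B}^{(p)}\boldsymbol{\Sigma}_1\boldsymbol{\beta}-\boldsymbol{B}^{(p)}\boldsymbol{\Sigma}_2\boldsymbol{\beta}'\|_2^2+\tfrac{c}{2}\|\boldsymbol{D}\boldsymbol{\Sigma}_1\boldsymbol{\beta}+\boldsymbol{D}\boldsymbol{\Sigma}_2\boldsymbol{\beta}'\|_2^2+\gamma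 T_K(\boldsymbol{\beta}).$$ Notation: $\|\boldsymbol{z}\|_0$ is the number of nonzero entries of $\boldsymbol{z}$. For $\boldsymbol{z}\in\mathbb{R}^d$ with entries ordered so that $|z_{(1)}|\ge\cdots\ge|z_{(d)}|$, $T_K(\boldsymbol{z})=|z_{(K+1)}|+\cdots+|z_{(d)}|$ (sum of the $d-K$ smallest absolute values); here $d=l-1$. *)

theory Defs
  imports Complex_Main
    "Jordan_Normal_Form.DL_Rank"
    "Jordan_Normal_Form.Gauss_Jordan_Elimination"
begin

text \<open>Rows, columns and vector entries are numbered from 0, whereas knots and B-splines keep
  their integer indices: the \<open>k\<close>-th column of a B-spline design matrix belongs to the basis
  function with index \<open>k - p\<close>.\<close>

definition l2norm :: "real vec \<Rightarrow> real" where
  "l2norm v = sqrt (v \<bullet> v)"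

definition l0norm :: "real vec \<Rightarrow> nat" where
  "l0norm v = card {i. i < dim_vec v \<and> v $ i \<noteq> 0}"

text \<open>The absolute values are sorted in decreasing order and the \<open>K\<close> largest are dropped.\<close>

definition trimmed_l1 :: "nat \<Rightarrow> real vec \<Rightarrow> real" where
  "trimmed_l1 K z = sum_list (drop K (rev (sort (map abs (list_of_vec z)))))"

definition local_min :: "nat \<Rightarrow> (real vec \<Rightarrow> real) \<Rightarrow> real vec \<Rightarrow> bool" where
  "local_min d f x \<longleftrightarrow> x \<in> carrier_vec d \<and>
     (\<exists>\<epsilon>>0. \<forall>u\<in>carrier_vec d. l2norm (u - x) < \<epsilon> \<longrightarrow> f x \<le> f u)"

text \<open>Unspecified for singular matrices.\<close>

definition mat_inv :: "real mat \<Rightarrow> real mat" where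
  "mat_inv X = the (mat_inverse X)"

fun bspline :: "(int \<Rightarrow> real) \<Rightarrow> nat \<Rightarrow> int \<Rightarrow> real \<Rightarrow> real" where
  "bspline t 0 j x = (if t j \<le> x \<and> x < t (j + 1) then 1 else 0)"
| "bspline t (Suc q) j x =
     (x - t j) / (t (j + int (Suc q)) - t j) * bspline t q j x
     + (t (j + int (Suc q) + 1) - x) / (t (j + int (Suc q) + 1) - t (j + 1)) * bspline t q (j + 1) x"

definition bspline_mat :: "nat \<Rightarrow> nat \<Rightarrow> (int \<Rightarrow> real) \<Rightarrow> real vec \<Rightarrow> real mat" where
  "bspline_mat p l t x = mat (dim_vec x) (l + p) (\<lambda>(i, k). bspline t p (int k - int p) (x $ i))"

definition first_diff_mat :: "nat \<Rightarrow> real mat" where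
  "first_diff_mat N = mat (N - 1) N (\<lambda>(i, k). if k = i then - 1 else if k = i + 1 then 1 else 0)"

primrec diff_mat :: "nat \<Rightarrow> nat \<Rightarrow> real mat" where
  "diff_mat N 0 = 1\<^sub>m N"
| "diff_mat N (Suc m) = first_diff_mat (N - m) * diff_mat N m"

text \<open>\<open>scaled_first_diff_mat l t q\<close> is the matrix \<open>\<Delta>\<close> with superscript \<open>q + 1\<close>; its row
  \<open>i\<close> is the row \<open>r = i + 1\<close> of the usual numbering from 1, with weight
  \<open>1 / (t r - t (r - q))\<close>.\<close>

definition scaled_first_diff_mat :: "nat \<Rightarrow> (int \<Rightarrow> real) \<Rightarrow> nat \<Rightarrow> real mat" where
  "scaled_first_diff_mat l t q = mat (l - 1 + q) (l + q) (\<lambda>(i, k).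
     let w = 1 / (t (int i + 1) - t (int i + 1 - int q))
     in if k = i then - w else if k = i + 1 then w else 0)"

text \<open>\<open>scaled_diff_mat l t q\<close> is the matrix \<open>D\<close> with superscript \<open>q + 1\<close>.\<close>

primrec scaled_diff_mat :: "nat \<Rightarrow> (int \<Rightarrow> real) \<Rightarrow> nat \<Rightarrow> real mat" where
  "scaled_diff_mat l t 0 = first_diff_mat l"
| "scaled_diff_mat l t (Suc q) = scaled_diff_mat l t q * scaled_first_diff_mat l t (Suc q)"

definition first_cols :: "nat \<Rightarrow> real mat \<Rightarrow> real mat" where
  "first_cols k X = mat (dim_row X) k (\<lambda>(i, j). X $$ (i, j))"

definition last_cols :: "nat \<Rightarrow> real mat \<Rightarrow> real mat" where
  "last_cols k X = mat (dim_row X) k (\<lambda>(i, j). X $$ (i, dim_col X - k + j))"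

end

theory Submission
  imports Defs "HOL-Analysis.L2_Norm"
begin

text \<open>The trimmed norm with parameter \<open>K\<close> is the minimum, over all index sets of size \<open>d - K\<close>, of the sum
  of the absolute values of the entries indexed by the set (\<open>trimmed_l1_le_sum\<close>,
  \<open>trimmed_l1_attained\<close>). A set that is optimal at a given point therefore gives a convex upper bound on
  the penalty that is exact at that point, and one-sided first-order conditions
  (\<open>local_min_least_squares_first_order\<close>) can be derived at a local minimum although the
  penalty is not convex.

  Sparsity (\<open>exact_penalty_sparsity\<close>) uses two such conditions. Scaling the local minimum \<open>\<beta>\<close>
  towards the origin shows that its residual is no longer than \<open>z\<close>, the residual of the zero vector.
  If \<open>\<beta>\<close> had more than \<open>K\<close> nonzero entries, then one of them would be counted by the
  penalty. Shrinking that entry gains at rate \<open>\<gamma>\<close> in the penalty and loses at most the product of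
  the norms of the residual and the corresponding column, which is smaller than \<open>\<gamma>\<close> by
  hypothesis. The two quadratic terms of the problem are merged into one by stacking
  (\<open>weighted_exact_penalty_sparsity\<close>).

  For the consequence, the change of variables writes every coefficient vector \<open>\<alpha>\<close> as the image
  under \<open>Sigma\<close> of a pair \<open>(\<beta>, v)\<close> with \<open>\<beta> = Dp \<alpha>\<close>, so the penalty depends on \<open>\<beta>\<close> only. Full
  column rank makes the quadratic form in \<open>v\<close> positive definite, and \<open>g \<beta>\<close> solves the normal
  equations for \<open>v\<close> (\<open>ridge_partial_minimizer\<close>). Substituting it shows that \<open>F \<beta>\<close> is the
  minimum over \<open>v\<close> of the original objective. Hence \<open>F\<close> composed with \<open>Dp\<close> is a minorant of the
  objective that touches it at the claimed point, and local minimality is inherited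
  (\<open>local_min_lift\<close>).\<close>

section \<open>Euclidean norms and matrix-vector products\<close>

lemma l2norm_power2: "(l2norm v)\<^sup>2 = v \<bullet> v"
  by (simp add: l2norm_def scalar_prod_def sum_nonneg)

lemma l2norm_eq_L2_set: "l2norm v = L2_set (\<lambda>i. v $ i) {..<dim_vec v}"
  by (simp add: l2norm_def L2_set_def scalar_prod_def power2_eq_square atLeast0LessThan)

lemma l2norm_nonneg: "0 \<le> l2norm v"
  by (simp add: l2norm_def scalar_prod_def sum_nonneg)

lemma l2norm_smult: "l2norm (a \<cdot>\<^sub>v v) = \<bar>a\<bar> * l2norm v"
proof -
  have "(a \<cdot>\<^sub>v v) \<bullet> (a \<cdot>\<^sub>v v) = a\<^sup>2 * (v \<bullet> v)"
    by (simp add: scalar_prod_def sum_distrib_left power2_eq_square mult_ac)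
  then show ?thesis
    by (simp add: l2norm_def real_sqrt_mult)
qed

lemma l2norm_append_power2: "(l2norm (v @\<^sub>v w))\<^sup>2 = (l2norm v)\<^sup>2 + (l2norm w)\<^sup>2"
  unfolding l2norm_power2
  by (rule scalar_prod_append[of v "dim_vec v" w "dim_vec w" v w]) simp_all

lemma Cauchy_Schwarz_vec:
  fixes v w :: "real vec"
  assumes "v \<in> carrier_vec N" "w \<in> carrier_vec N"
  shows "\<bar>v \<bullet> w\<bar> \<le> l2norm v * l2norm w"
proof -
  have "\<bar>v \<bullet> w\<bar> \<le> (\<Sum>i<N. \<bar>v $ i\<bar> * \<bar>w $ i\<bar>)"
    using assms sum_abs[of "\<lambda>i. v $ i * w $ i" "{..<N}"]
    by (simp add: scalar_prod_def atLeast0LessThan abs_mult)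
  also have "\<dots> \<le> L2_set (\<lambda>i. v $ i) {..<N} * L2_set (\<lambda>i. w $ i) {..<N}"
    by (rule L2_set_mult_ineq)
  finally show ?thesis
    using assms by (simp add: l2norm_eq_L2_set)
qed

text \<open>Every quadratic function in this development is expanded along a line by this identity.\<close>
lemma scalar_prod_add_smult_self:
  fixes a b :: "real vec"
  assumes [simp]: "a \<in> carrier_vec N" "b \<in> carrier_vec N"
  shows "(a + s \<cdot>\<^sub>v b) \<bullet> (a + s \<cdot>\<^sub>v b) = a \<bullet> a + 2 * s * (a \<bullet> b) + s\<^sup>2 * (b \<bullet> b)"
proof -
  have "b \<bullet> a = a \<bullet> b"
    by (rule comm_scalar_prod[of _ N]) simp_all
  then have "(a + s \<cdot>\<^sub>v b) \<bullet> (a + s \<cdot>\<^sub>v b) = a \<bullet> a + s * (a \<bullet> b) + (s * (a \<bullet> b) + s * (s * (b \<bullet> b)))"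
    by (simp add: add_scalar_prod_distrib[of _ N] scalar_prod_add_distrib[of _ N]
        smult_scalar_prod_distrib[of _ N] scalar_prod_smult_distrib[of _ N] distrib_left)
  then show ?thesis
    by (simp add: power2_eq_square)
qed

text \<open>The sum of the norms of the rows is a crude operator-norm bound, by the Cauchy-Schwarz inequality
  in each row; the summand 1 makes the constant positive even when the matrix is zero. This is how
  continuity of linear maps enters the argument.\<close>
lemma l2norm_mult_mat_vec_bound:
  assumes "P \<in> carrier_mat r k"
  obtains C where "C > 0" "\<And>v. v \<in> carrier_vec k \<Longrightarrow> l2norm (P *\<^sub>v v) \<le> C * l2norm v"
proof
  let ?C = "1 + (\<Sum>i<r. l2norm (row P i))"
  show "?C > 0"
    by (intro add_pos_nonneg sum_nonneg l2norm_nonneg) simp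
  fix v :: "real vec" assume v: "v \<in> carrier_vec k"
  have "l2norm (P *\<^sub>v v) \<le> (\<Sum>i<r. \<bar>(P *\<^sub>v v) $ i\<bar>)"
    using assms L2_set_le_sum_abs[of "\<lambda>i. (P *\<^sub>v v) $ i" "{..<r}"]
    by (simp only: l2norm_eq_L2_set dim_mult_mat_vec carrier_matD)
  also have "\<dots> \<le> (\<Sum>i<r. l2norm (row P i) * l2norm v)"
  proof (rule sum_mono)
    fix i assume "i \<in> {..<r}"
    then show "\<bar>(P *\<^sub>v v) $ i\<bar> \<le> l2norm (row P i) * l2norm v"
      using assms v by (auto intro!: Cauchy_Schwarz_vec[of _ k])
  qed
  also have "\<dots> \<le> ?C * l2norm v"
    by (simp add: sum_distrib_right distrib_right l2norm_nonneg)
  finally show "l2norm (P *\<^sub>v v) \<le> ?C * l2norm v" .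
qed

lemma mult_unit_vec_eq_col:
  fixes X :: "real mat"
  assumes "X \<in> carrier_mat r d" "j < d"
  shows "X *\<^sub>v unit_vec d j = col X j"
  using assms by (intro eq_vecI) auto

lemma smult_mat_mult_vec:
  fixes X :: "real mat"
  assumes "X \<in> carrier_mat k d" "v \<in> carrier_vec d"
  shows "(c \<cdot>\<^sub>m X) *\<^sub>v v = c \<cdot>\<^sub>v (X *\<^sub>v v)"
  using assms by (intro eq_vecI) (auto simp: smult_scalar_prod_distrib[of _ d])

section \<open>The trimmed l1 norm as a minimum over index sets\<close>

text \<open>An exchange argument: \<open>S\<close> and the final segment have the same size, hence so do their
  differences, and \<open>w K\<close> separates the values on one difference from those on the other.\<close>
lemma sum_final_segment_le:
  fixes w :: "nat \<Rightarrow> real"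
  assumes anti: "\<And>i j. i \<le> j \<Longrightarrow> j < d \<Longrightarrow> w j \<le> w i"
    and S: "S \<subseteq> {..<d}" "card S = d - K"
  shows "sum w {K..<d} \<le> sum w S"
proof (cases "K < d")
  case False
  then show ?thesis
    using S by (simp add: finite_subset[OF S(1)])
next
  case True
  let ?T = "{K..<d}"
  have fin: "finite S"
    using S(1) finite_subset by blast
  have card: "card (?T - S) = card (S - ?T)"
    using S(2) fin by (simp add: card_Diff_subset_Int Int_commute)
  have "sum w (?T - S) \<le> of_nat (card (?T - S)) * w K"
    by (rule sum_bounded_above) (auto intro: anti)
  also have "\<dots> = of_nat (card (S - ?T)) * w K"
    by (simp add: card)
  also have "\<dots> \<le> sum w (S - ?T)"
  proof (rule sum_bounded_below)
    fix i assume "i \<in> S - ?T"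
    then have "i \<le> K"
      using S(1) by auto
    then show "w K \<le> w i"
      using anti True by simp
  qed
  finally show ?thesis
    using sum.Int_Diff[of ?T w S] sum.Int_Diff[of S w ?T] fin by (simp add: Int_commute)
qed

text \<open>Sorting the absolute values is permuting the coordinates. With the sorting permutation at hand,
  sorted lists no longer occur.\<close>
lemma trimmed_l1_sorting:
  fixes z :: "real vec"
  assumes z: "z \<in> carrier_vec d"
  obtains \<pi> where "\<pi> permutes {..<d}"
    "\<And>i j. i \<le> j \<Longrightarrow> j < d \<Longrightarrow> \<bar>z $ \<pi> j\<bar> \<le> \<bar>z $ \<pi> i\<bar>"
    "trimmed_l1 K z = (\<Sum>i = K..<d. \<bar>z $ \<pi> i\<bar>)"
proof -
  define xs where "xs = map abs (list_of_vec z)"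
  define ys where "ys = rev (sort xs)"
  have len: "length xs = d" "length ys = d"
    using z by (simp_all add: xs_def ys_def)
  have "mset ys = mset xs"
    by (simp add: ys_def)
  then obtain \<pi> where \<pi>: "\<pi> permutes {..<d}" "permute_list \<pi> xs = ys"
    using len by (metis mset_eq_permutation)
  have ys: "ys ! i = \<bar>z $ \<pi> i\<bar>" if "i < d" for i
  proof -
    have "\<pi> i < d"
      using permutes_in_image[OF \<pi>(1)] that by simp
    then show ?thesis
      using \<pi> len that z permute_list_nth[of \<pi> xs i]
      by (auto simp: xs_def list_of_vec_index)
  qed
  have "ys ! j \<le> ys ! i" if "i \<le> j" "j < d" for i j
    using that len sorted_rev_nth_mono[of ys i j] by (simp add: ys_def)
  moreover have "trimmed_l1 K z = (\<Sum>i = K..<d. \<bar>z $ \<pi> i\<bar>)"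
  proof -
    have "trimmed_l1 K z = (\<Sum>i<d - K. ys ! (K + i))"
      using len
      by (simp add: trimmed_l1_def xs_def[symmetric] ys_def[symmetric] sum_list_sum_nth
          atLeast0LessThan)
    also have "\<dots> = (\<Sum>i = K..<d. ys ! i)"
      by (rule sum.reindex_bij_witness[of _ "\<lambda>i. i - K" "\<lambda>i. K + i"]) auto
    finally show ?thesis
      by (simp add: ys)
  qed
  ultimately show thesis
    using that[OF \<pi>(1)] ys by (metis le_less_trans)
qed

text \<open>Together with the attainment below, this presents the trimmed norm as the minimum of the sums
  of absolute values over all index sets of size \<open>d - K\<close>. The trimmed norm is not convex, but it
  lies below the convex function given by an index set that is optimal at a chosen point, with
  equality there, and an upper bound of this kind suffices for a necessary condition at a local minimum.\<close>
lemma trimmed_l1_le_sum: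
  assumes z: "z \<in> carrier_vec d" and S: "S \<subseteq> {..<d}" "card S = d - K"
  shows "trimmed_l1 K z \<le> (\<Sum>i\<in>S. \<bar>z $ i\<bar>)"
proof -
  obtain \<pi> where \<pi>: "\<pi> permutes {..<d}"
    "\<And>i j. i \<le> j \<Longrightarrow> j < d \<Longrightarrow> \<bar>z $ \<pi> j\<bar> \<le> \<bar>z $ \<pi> i\<bar>"
    "trimmed_l1 K z = (\<Sum>i = K..<d. \<bar>z $ \<pi> i\<bar>)"
    using trimmed_l1_sorting[OF z, of K thesis] by blast
  let ?S = "{i \<in> {..<d}. \<pi> i \<in> S}"
  have inj: "inj_on \<pi> ?S"
    using permutes_inj[OF \<pi>(1)] by (rule inj_on_subset) simp
  have im: "\<pi> ` ?S = S"
    using S(1) permutes_image[OF \<pi>(1)] by auto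
  have "card ?S = d - K"
    using S(2) card_image[OF inj] im by simp
  then have "trimmed_l1 K z \<le> (\<Sum>i\<in>?S. \<bar>z $ \<pi> i\<bar>)"
    unfolding \<pi>(3) using \<pi>(2) by (intro sum_final_segment_le) auto
  also have "\<dots> = (\<Sum>i\<in>S. \<bar>z $ i\<bar>)"
    using sum.reindex[OF inj, of "\<lambda>i. \<bar>z $ i\<bar>"] im by simp
  finally show ?thesis .
qed

lemma trimmed_l1_attained:
  assumes z: "z \<in> carrier_vec d"
  obtains S where "S \<subseteq> {..<d}" "card S = d - K" "trimmed_l1 K z = (\<Sum>i\<in>S. \<bar>z $ i\<bar>)"
proof -
  obtain \<pi> where \<pi>: "\<pi> permutes {..<d}" "trimmed_l1 K z = (\<Sum>i = K..<d. \<bar>z $ \<pi> i\<bar>)"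
    using trimmed_l1_sorting[OF z] by metis
  have inj: "inj_on \<pi> {K..<d}"
    using permutes_inj[OF \<pi>(1)] by (rule inj_on_subset) simp
  show thesis
  proof (rule that)
    show "\<pi> ` {K..<d} \<subseteq> {..<d}"
      using permutes_image[OF \<pi>(1)] by fastforce
    show "card (\<pi> ` {K..<d}) = d - K"
      by (simp add: card_image[OF inj])
    show "trimmed_l1 K z = (\<Sum>i\<in>\<pi> ` {K..<d}. \<bar>z $ i\<bar>)"
      by (simp add: \<pi>(2) sum.reindex[OF inj])
  qed
qed

section \<open>Local minima of penalised least squares are sparse\<close>

text \<open>Moving from the local minimum by \<open>- s\<close> times \<open>w\<close> lowers \<open>h\<close> by at least \<open>s * \<tau>\<close>, while the
  least squares term rises by \<open>s\<close> times the inner product on the right plus a term of order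
  \<open>s\<^sup>2\<close>. Dividing by \<open>s\<close> and letting it shrink compares the two rates. Only a one-sided rate of
  descent is asked of \<open>h\<close>, since the trimmed norm is neither convex nor smooth.\<close>
lemma local_min_least_squares_first_order:
  assumes L: "L \<in> carrier_mat N d" and z: "z \<in> carrier_vec N" and w: "w \<in> carrier_vec d"
    and min: "local_min d (\<lambda>\<beta>. 1 / 2 * (l2norm (z - L *\<^sub>v \<beta>))\<^sup>2 + h \<beta>) \<beta>"
    and s0: "s0 > 0"
    and descent: "\<And>s. 0 < s \<Longrightarrow> s \<le> s0 \<Longrightarrow> h (\<beta> - s \<cdot>\<^sub>v w) \<le> h \<beta> - s * \<tau>"
  shows "\<tau> \<le> (z - L *\<^sub>v \<beta>) \<bullet> (L *\<^sub>v w)"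
proof (rule field_le_epsilon)
  fix e :: real assume e: "e > 0"
  define r where "r = z - L *\<^sub>v \<beta>"
  define q where "q = L *\<^sub>v w"
  have \<beta>: "\<beta> \<in> carrier_vec d"
    using min by (simp add: local_min_def)
  have r: "r \<in> carrier_vec N" and q: "q \<in> carrier_vec N"
    using L z w \<beta> by (simp_all add: r_def q_def)
  obtain \<epsilon> where \<epsilon>: "\<epsilon> > 0" and le: "\<And>u. u \<in> carrier_vec d \<Longrightarrow> l2norm (u - \<beta>) < \<epsilon> \<Longrightarrow>
      1 / 2 * (l2norm (z - L *\<^sub>v \<beta>))\<^sup>2 + h \<beta> \<le> 1 / 2 * (l2norm (z - L *\<^sub>v u))\<^sup>2 + h u"
    using min by (auto simp: local_min_def)
  \<comment> \<open>The three entries keep the step inside the range of the descent hypothesis, inside the neighbourhood of minimality, and small enough for the second-order term to be at most e.\<close>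
  define s where "s = Min {s0, \<epsilon> / (2 * (l2norm w + 1)), 2 * e / (q \<bullet> q + 1)}"
  have qq: "0 \<le> q \<bullet> q" and ww: "0 \<le> l2norm w"
    by (simp_all add: l2norm_power2[symmetric] l2norm_nonneg)
  have s: "0 < s" "s \<le> s0" "s \<le> \<epsilon> / (2 * (l2norm w + 1))" "s \<le> 2 * e / (q \<bullet> q + 1)"
  proof -
    have "0 < \<epsilon> / (2 * (l2norm w + 1))" "0 < 2 * e / (q \<bullet> q + 1)"
      using \<epsilon> e qq ww by (simp_all add: zero_less_divide_iff add_nonneg_pos)
    then show "0 < s"
      using s0 by (simp add: s_def)
  qed (simp_all add: s_def)
  have "s * (2 * (l2norm w + 1)) \<le> \<epsilon>"
    using s(3) ww by (simp add: pos_le_divide_eq)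
  moreover have "0 \<le> s * l2norm w"
    using s(1) ww by simp
  ultimately have "s * l2norm w < \<epsilon>"
    using s(1) by (simp add: distrib_left)
  moreover have "\<beta> - s \<cdot>\<^sub>v w - \<beta> = (- s) \<cdot>\<^sub>v w"
    using \<beta> w by (intro eq_vecI) auto
  ultimately have near: "l2norm (\<beta> - s \<cdot>\<^sub>v w - \<beta>) < \<epsilon>"
    using s(1) by (simp add: l2norm_smult)
  have "L *\<^sub>v (\<beta> - s \<cdot>\<^sub>v w) = L *\<^sub>v \<beta> - s \<cdot>\<^sub>v q"
    using L \<beta> w by (simp add: q_def mult_minus_distrib_mat_vec[of _ N d] mult_mat_vec[of _ N d])
  then have res: "z - L *\<^sub>v (\<beta> - s \<cdot>\<^sub>v w) = r + s \<cdot>\<^sub>v q"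
    using L z \<beta> q by (intro eq_vecI) (auto simp: r_def)
  have "1 / 2 * (r \<bullet> r) + h \<beta>
      \<le> 1 / 2 * ((r + s \<cdot>\<^sub>v q) \<bullet> (r + s \<cdot>\<^sub>v q)) + h (\<beta> - s \<cdot>\<^sub>v w)"
    using le[of "\<beta> - s \<cdot>\<^sub>v w"] near \<beta> w by (simp add: res l2norm_power2 r_def)
  also have "\<dots> \<le> 1 / 2 * (r \<bullet> r + 2 * s * (r \<bullet> q) + s\<^sup>2 * (q \<bullet> q)) + (h \<beta> - s * \<tau>)"
    using descent[OF s(1,2)] by (simp add: scalar_prod_add_smult_self[OF r q])
  finally have "s * \<tau> \<le> s * (r \<bullet> q + s / 2 * (q \<bullet> q))"
    by (simp add: algebra_simps power2_eq_square)
  then have "\<tau> \<le> r \<bullet> q + s / 2 * (q \<bullet> q)"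
    using s(1) by simp
  also have "s / 2 * (q \<bullet> q) \<le> s / 2 * (q \<bullet> q + 1)"
    using s(1) by simp
  also have "\<dots> \<le> e"
    using s(4) qq by (simp add: pos_le_divide_eq)
  finally show "\<tau> \<le> (z - L *\<^sub>v \<beta>) \<bullet> (L *\<^sub>v w) + e"
    by (simp add: r_def q_def)
qed

text \<open>Apply the first-order condition twice, where \<open>r\<close> is the residual at \<open>\<beta>\<close>. In the direction \<open>\<beta>\<close> itself,
  along which the penalty is homogeneous, it says that \<open>r\<close> makes a nonnegative inner product with
  \<open>L \<beta>\<close>; as \<open>z\<close> is the sum of these two vectors, \<open>r\<close> is no longer than \<open>z\<close>.
  If more than \<open>K\<close> entries were nonzero, some nonzero entry \<open>\<beta> $ j\<close> would be among those that
  the penalty sums. Shrinking it lowers the penalty at rate \<open>\<gamma>\<close>, and the least squares term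
  can only make up for this if \<open>\<gamma>\<close> is at most the inner product of \<open>r\<close> with the
  \<open>j\<close>-th column of \<open>L\<close> up to sign, hence at most the product of the norms of \<open>z\<close> and
  that column, contrary to the bound on \<open>\<gamma>\<close>.\<close>
lemma exact_penalty_sparsity:
  assumes L: "L \<in> carrier_mat N d" and z: "z \<in> carrier_vec N"
    and \<gamma>: "\<And>j. j < d \<Longrightarrow> l2norm (L *\<^sub>v unit_vec d j) * l2norm z < \<gamma>"
    and min: "local_min d (\<lambda>\<beta>. 1 / 2 * (l2norm (z - L *\<^sub>v \<beta>))\<^sup>2 + \<gamma> * trimmed_l1 K \<beta>) \<beta>"
  shows "l0norm \<beta> \<le> K"
proof (rule ccontr)
  assume "\<not> l0norm \<beta> \<le> K"
  then have many: "K < card {i. i < d \<and> \<beta> $ i \<noteq> 0}"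
    using min by (auto simp: local_min_def l0norm_def)
  have \<beta>: "\<beta> \<in> carrier_vec d"
    using min by (simp add: local_min_def)
  define r where "r = z - L *\<^sub>v \<beta>"
  have r: "r \<in> carrier_vec N"
    using L z \<beta> by (simp add: r_def)
  obtain S where S: "S \<subseteq> {..<d}" "card S = d - K" and T: "trimmed_l1 K \<beta> = (\<Sum>i\<in>S. \<bar>\<beta> $ i\<bar>)"
    by (rule trimmed_l1_attained[OF \<beta>])
  have fin: "finite S"
    using S(1) finite_subset by blast
  \<comment> \<open>At most K indices lie outside S, so they cannot contain the whole support.\<close>
  have "\<not> {i. i < d \<and> \<beta> $ i \<noteq> 0} \<subseteq> {..<d} - S"
  proof
    assume "{i. i < d \<and> \<beta> $ i \<noteq> 0} \<subseteq> {..<d} - S"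
    then have "card {i. i < d \<and> \<beta> $ i \<noteq> 0} \<le> card ({..<d} - S)"
      by (intro card_mono) auto
    also have "\<dots> \<le> K"
      using S fin by (simp add: card_Diff_subset)
    finally show False
      using many by simp
  qed
  then obtain j where j: "j < d" "j \<in> S" "\<beta> $ j \<noteq> 0"
    by auto
  have \<gamma>0: "0 \<le> \<gamma>"
    using \<gamma>[OF j(1)] l2norm_nonneg by (smt (verit) mult_nonneg_nonneg)
  \<comment> \<open>First-order condition in the direction of the local minimum itself.\<close>
  have "0 \<le> \<gamma> * trimmed_l1 K \<beta>"
    using \<gamma>0 by (simp add: T sum_nonneg)
  also have "\<dots> \<le> r \<bullet> (L *\<^sub>v \<beta>)"
    unfolding r_def
  proof (rule local_min_least_squares_first_order[OF L z \<beta> min, of 1])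
    fix s :: real assume s: "0 < s" "s \<le> 1"
    have "trimmed_l1 K (\<beta> - s \<cdot>\<^sub>v \<beta>) \<le> (\<Sum>i\<in>S. \<bar>(\<beta> - s \<cdot>\<^sub>v \<beta>) $ i\<bar>)"
      using \<beta> S by (intro trimmed_l1_le_sum[of _ d]) auto
    also have "\<dots> = (\<Sum>i\<in>S. (1 - s) * \<bar>\<beta> $ i\<bar>)"
    proof (rule sum.cong)
      fix i assume "i \<in> S"
      then have "(\<beta> - s \<cdot>\<^sub>v \<beta>) $ i = (1 - s) * \<beta> $ i"
        using \<beta> S(1) by (auto simp: algebra_simps)
      then show "\<bar>(\<beta> - s \<cdot>\<^sub>v \<beta>) $ i\<bar> = (1 - s) * \<bar>\<beta> $ i\<bar>"
        using s by (simp add: abs_mult)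
    qed simp
    also have "\<dots> = trimmed_l1 K \<beta> - s * trimmed_l1 K \<beta>"
      by (simp add: T left_diff_distrib sum_subtractf sum_distrib_left)
    finally show "\<gamma> * trimmed_l1 K (\<beta> - s \<cdot>\<^sub>v \<beta>)
        \<le> \<gamma> * trimmed_l1 K \<beta> - s * (\<gamma> * trimmed_l1 K \<beta>)"
      using mult_left_mono[OF _ \<gamma>0] by (fastforce simp: algebra_simps)
  qed simp
  finally have rq: "0 \<le> r \<bullet> (L *\<^sub>v \<beta>)" .
  have "z = r + 1 \<cdot>\<^sub>v (L *\<^sub>v \<beta>)"
    using L z \<beta> by (intro eq_vecI) (auto simp: r_def)
  then have "z \<bullet> z = r \<bullet> r + 2 * (r \<bullet> (L *\<^sub>v \<beta>)) + (l2norm (L *\<^sub>v \<beta>))\<^sup>2"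
    using scalar_prod_add_smult_self[OF r, of "L *\<^sub>v \<beta>" 1] L \<beta> by (simp add: l2norm_power2)
  then have res_le: "l2norm r \<le> l2norm z"
    using rq by (simp add: l2norm_def)
  \<comment> \<open>First-order condition in the direction that shrinks the j-th entry towards 0.\<close>
  let ?e = "sgn (\<beta> $ j) \<cdot>\<^sub>v unit_vec d j"
  have "\<gamma> \<le> r \<bullet> (L *\<^sub>v ?e)"
    unfolding r_def
  proof (rule local_min_least_squares_first_order[OF L z _ min, of _ "\<bar>\<beta> $ j\<bar>"])
    fix s :: real assume s: "0 < s" "s \<le> \<bar>\<beta> $ j\<bar>"
    have "trimmed_l1 K (\<beta> - s \<cdot>\<^sub>v ?e) \<le> (\<Sum>i\<in>S. \<bar>(\<beta> - s \<cdot>\<^sub>v ?e) $ i\<bar>)"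
      using \<beta> S by (intro trimmed_l1_le_sum[of _ d]) auto
    also have "\<dots> = (\<Sum>i\<in>S. \<bar>\<beta> $ i\<bar> - (if i = j then s else 0))"
    proof (rule sum.cong)
      fix i assume "i \<in> S"
      then show "\<bar>(\<beta> - s \<cdot>\<^sub>v ?e) $ i\<bar> = \<bar>\<beta> $ i\<bar> - (if i = j then s else 0)"
        using \<beta> S(1) s j by (auto simp: sgn_if unit_vec_def)
    qed simp
    also have "\<dots> = trimmed_l1 K \<beta> - s"
      using fin j(2) by (simp add: T sum_subtractf)
    finally show "\<gamma> * trimmed_l1 K (\<beta> - s \<cdot>\<^sub>v ?e) \<le> \<gamma> * trimmed_l1 K \<beta> - s * \<gamma>"
      using mult_left_mono[OF _ \<gamma>0] by (fastforce simp: algebra_simps)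
  qed (use j in auto)
  also have "\<dots> \<le> \<bar>r \<bullet> (L *\<^sub>v ?e)\<bar>"
    by simp
  also have "\<dots> \<le> l2norm r * l2norm (L *\<^sub>v ?e)"
    using L r by (intro Cauchy_Schwarz_vec[of _ N]) auto
  also have "l2norm (L *\<^sub>v ?e) = l2norm (L *\<^sub>v unit_vec d j)"
    using L j by (simp add: mult_mat_vec[of _ N d] l2norm_smult abs_sgn_eq)
  also have "l2norm r * l2norm (L *\<^sub>v unit_vec d j) \<le> l2norm z * l2norm (L *\<^sub>v unit_vec d j)"
    by (rule mult_right_mono[OF res_le l2norm_nonneg])
  also have "\<dots> < \<gamma>"
    using \<gamma>[OF j(1)] by (simp only: mult.commute)
  finally show False
    by simp
qed

text \<open>Stacking the two residuals, the second scaled by \<open>sqrt c\<close>, turns the weighted sum of two squares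
  into a single one. The norm of a stacked column is at most the sum of the norms of
  its two blocks, which gives the bound on \<open>\<gamma>\<close> its shape.\<close>
lemma weighted_exact_penalty_sparsity:
  assumes L1: "L1 \<in> carrier_mat n d" and L2: "L2 \<in> carrier_mat e d"
    and z1: "z1 \<in> carrier_vec n" and z2: "z2 \<in> carrier_vec e" and c: "0 \<le> c"
    and \<gamma>: "\<And>j. j < d \<Longrightarrow> (l2norm (col L1 j) + sqrt c * l2norm (col L2 j))
        * sqrt ((l2norm z1)\<^sup>2 + c * (l2norm z2)\<^sup>2) < \<gamma>"
    and F: "\<And>\<beta>. F \<beta> = 1 / 2 * (l2norm (z1 - L1 *\<^sub>v \<beta>))\<^sup>2 + c / 2 * (l2norm (z2 - L2 *\<^sub>v \<beta>))\<^sup>2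
        + \<gamma> * trimmed_l1 K \<beta>"
    and min: "local_min d F \<beta>"
  shows "l0norm \<beta> \<le> K"
proof (rule exact_penalty_sparsity)
  let ?L = "L1 @\<^sub>r (sqrt c \<cdot>\<^sub>m L2)" and ?z = "z1 @\<^sub>v (sqrt c \<cdot>\<^sub>v z2)"
  have cL2: "sqrt c \<cdot>\<^sub>m L2 \<in> carrier_mat e d"
    using L2 by simp
  have Lv: "?L *\<^sub>v v = (L1 *\<^sub>v v) @\<^sub>v (sqrt c \<cdot>\<^sub>v (L2 *\<^sub>v v))" if "v \<in> carrier_vec d" for v
    unfolding mat_mult_append[OF L1 cL2 that] smult_mat_mult_vec[OF L2 that] ..
  have norm: "(l2norm (u @\<^sub>v (sqrt c \<cdot>\<^sub>v w)))\<^sup>2 = (l2norm u)\<^sup>2 + c * (l2norm w)\<^sup>2" for u w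
    using c by (simp add: l2norm_append_power2 l2norm_smult power_mult_distrib)
  show "?L \<in> carrier_mat (n + e) d"
    using L1 cL2 by (rule carrier_append_rows)
  show "?z \<in> carrier_vec (n + e)"
    using z1 z2 by simp
  show "l2norm (?L *\<^sub>v unit_vec d j) * l2norm ?z < \<gamma>" if j: "j < d" for j
  proof -
    have "l2norm (?L *\<^sub>v unit_vec d j) = sqrt ((l2norm (?L *\<^sub>v unit_vec d j))\<^sup>2)"
      by (simp add: l2norm_nonneg)
    also have "\<dots> = sqrt ((l2norm (col L1 j))\<^sup>2 + (sqrt c * l2norm (col L2 j))\<^sup>2)"
      using c by (simp add: Lv norm mult_unit_vec_eq_col[OF L1 j] mult_unit_vec_eq_col[OF L2 j]
          power_mult_distrib)
    also have "\<dots> \<le> l2norm (col L1 j) + sqrt c * l2norm (col L2 j)"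
      using c by (intro sqrt_sum_squares_le_sum) (simp_all add: l2norm_nonneg)
    finally have "l2norm (?L *\<^sub>v unit_vec d j) * l2norm ?z
        \<le> (l2norm (col L1 j) + sqrt c * l2norm (col L2 j)) * l2norm ?z"
      by (rule mult_right_mono[OF _ l2norm_nonneg])
    moreover have "l2norm ?z = sqrt ((l2norm z1)\<^sup>2 + c * (l2norm z2)\<^sup>2)"
      using norm[of z1 z2] l2norm_nonneg[of ?z] by (metis real_sqrt_unique)
    ultimately show ?thesis
      using \<gamma>[OF j] by simp
  qed
  have "1 / 2 * (l2norm (?z - ?L *\<^sub>v u))\<^sup>2 + \<gamma> * trimmed_l1 K u = F u" if u: "u \<in> carrier_vec d" for u
  proof -
    have "?z - ?L *\<^sub>v u = (z1 - L1 *\<^sub>v u) @\<^sub>v (sqrt c \<cdot>\<^sub>v (z2 - L2 *\<^sub>v u))"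
      unfolding Lv[OF u] using L1 L2 z1 z2 u by (intro eq_vecI) (auto simp: right_diff_distrib)
    then show ?thesis
      by (simp add: norm F distrib_left)
  qed
  then show "local_min d (\<lambda>\<beta>. 1 / 2 * (l2norm (?z - ?L *\<^sub>v \<beta>))\<^sup>2 + \<gamma> * trimmed_l1 K \<beta>) \<beta>"
    using min by (simp add: local_min_def)
qed

section \<open>Eliminating the unpenalised variables\<close>

text \<open>The rank is the size of a maximal independent set of columns. If it equals the number
  of columns, no column is repeated and all of them together are independent, so that a
  vanishing combination has zero coefficients.\<close>
lemma full_column_rank_imp_trivial_kernel:
  fixes A :: "real mat"
  assumes A: "A \<in> carrier_mat n k" and rank: "vec_space.rank n A = k"
    and v: "v \<in> carrier_vec k" "A *\<^sub>v v = 0\<^sub>v n"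
  shows "v = 0\<^sub>v k"
proof (rule ccontr)
  assume nz: "v \<noteq> 0\<^sub>v k"
  interpret vec_space "TYPE(real)" n .
  obtain S where S: "maximal S (\<lambda>T. T \<subseteq> set (cols A) \<and> lin_indpt T)"
    using maximal_exists[of "\<lambda>T. T \<subseteq> set (cols A) \<and> lin_indpt T" "card (set (cols A))" "{}"]
    by (meson List.finite_set card_mono empty_iff empty_subsetI finite_lin_indpt2 rev_finite_subset)
  have "k = card S"
    using rank_card_indpt[OF A S] rank by simp
  also have "\<dots> \<le> card (set (cols A))"
    using S by (simp add: card_mono maximal_def)
  finally have "distinct (cols A)"
    using A card_length[of "cols A"] by (intro card_distinct) simp
  then show False
    using full_rank_lin_indpt[OF A rank] lin_depI[OF A v(1) nz v(2)] by blast
qed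

lemma mat_inv_of_trivial_kernel:
  assumes X: "X \<in> carrier_mat k k"
    and ker: "\<And>v. v \<in> carrier_vec k \<Longrightarrow> X *\<^sub>v v = 0\<^sub>v k \<Longrightarrow> v = 0\<^sub>v k"
  shows "mat_inv X \<in> carrier_mat k k" "X * mat_inv X = 1\<^sub>m k" "mat_inv X * X = 1\<^sub>m k"
proof -
  have "det X \<noteq> 0"
    using ker det_0_iff_vec_prod_zero_field[OF X] by auto
  then have "X \<in> Units (ring_mat TYPE(real) k ())"
    by (rule det_non_zero_imp_unit[OF X])
  then obtain Y where "mat_inverse X = Some Y"
    using mat_inverse(1)[OF X, where b = "()"] by (cases "mat_inverse X") auto
  then show "mat_inv X \<in> carrier_mat k k" "X * mat_inv X = 1\<^sub>m k" "mat_inv X * X = 1\<^sub>m k"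
    using mat_inverse(2)[OF X] by (simp_all add: mat_inv_def)
qed

lemma mat_inv_of_invertible:
  assumes X: "X \<in> carrier_mat k k" and inv: "invertible_mat X"
  shows "mat_inv X \<in> carrier_mat k k" "X * mat_inv X = 1\<^sub>m k" "mat_inv X * X = 1\<^sub>m k"
proof -
  obtain Y where Y: "X * Y = 1\<^sub>m k" "Y * X = 1\<^sub>m (dim_row Y)"
    using inv X by (auto simp: invertible_mat_def inverts_mat_def)
  have "dim_row Y = k"
    using arg_cong[OF Y(2), of dim_col] X by simp
  moreover have "dim_col Y = k"
    using arg_cong[OF Y(1), of dim_col] by simp
  ultimately have Yc: "Y \<in> carrier_mat k k"
    by (intro carrier_matI)
  have ker: "v = 0\<^sub>v k" if "v \<in> carrier_vec k" "X *\<^sub>v v = 0\<^sub>v k" for v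
  proof -
    have "v = (Y * X) *\<^sub>v v"
      using Y(2) Yc that(1) by simp
    also have "\<dots> = Y *\<^sub>v (X *\<^sub>v v)"
      using Yc X that(1) by simp
    also have "\<dots> = 0\<^sub>v k"
      using that(2) Yc by (intro eq_vecI) (auto simp: scalar_prod_def)
    finally show ?thesis .
  qed
  show "mat_inv X \<in> carrier_mat k k" "X * mat_inv X = 1\<^sub>m k" "mat_inv X * X = 1\<^sub>m k"
    using mat_inv_of_trivial_kernel[OF X ker] by auto
qed

text \<open>The signs are those of the partial problem: the block \<open>P\<close> is subtracted in its residual, and
  \<open>Q\<close> is added in its own. The normal equations cancel the cross terms in the
  expansion around \<open>v0\<close>, and what remains is a nonnegative quadratic form.\<close>
lemma normal_equations_imp_minimizer:
  assumes P: "P \<in> carrier_mat n k" and Q: "Q \<in> carrier_mat e k" and c: "0 \<le> c"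
    and a: "a \<in> carrier_vec n" and b: "b \<in> carrier_vec e"
    and v0: "v0 \<in> carrier_vec k" and v: "v \<in> carrier_vec k"
    and normal: "P\<^sup>T *\<^sub>v (a - P *\<^sub>v v0) = c \<cdot>\<^sub>v (Q\<^sup>T *\<^sub>v (b + Q *\<^sub>v v0))"
  shows "1 / 2 * (l2norm (a - P *\<^sub>v v0))\<^sup>2 + c / 2 * (l2norm (b + Q *\<^sub>v v0))\<^sup>2
    \<le> 1 / 2 * (l2norm (a - P *\<^sub>v v))\<^sup>2 + c / 2 * (l2norm (b + Q *\<^sub>v v))\<^sup>2"
proof -
  define r1 r2 h where defs: "r1 = a - P *\<^sub>v v0" "r2 = b + Q *\<^sub>v v0" "h = v - v0"
  have r1: "r1 \<in> carrier_vec n" and r2: "r2 \<in> carrier_vec e" and h: "h \<in> carrier_vec k"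
    using P Q a b v0 v by (simp_all add: defs)
  have Ph: "P *\<^sub>v h \<in> carrier_vec n" and Qh: "Q *\<^sub>v h \<in> carrier_vec e"
    using P Q h by simp_all
  have Ph_eq: "P *\<^sub>v h = P *\<^sub>v v - P *\<^sub>v v0" and Qh_eq: "Q *\<^sub>v h = Q *\<^sub>v v - Q *\<^sub>v v0"
    unfolding defs
    by (rule mult_minus_distrib_mat_vec[OF P v v0], rule mult_minus_distrib_mat_vec[OF Q v v0])
  have e1: "a - P *\<^sub>v v = r1 + (- 1) \<cdot>\<^sub>v (P *\<^sub>v h)"
    unfolding Ph_eq unfolding defs(1) using P a v v0 by (intro eq_vecI) auto
  have e2: "b + Q *\<^sub>v v = r2 + 1 \<cdot>\<^sub>v (Q *\<^sub>v h)"
    unfolding Qh_eq unfolding defs(2) using Q b v v0 by (intro eq_vecI) auto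
  have "r1 \<bullet> (P *\<^sub>v h) = (P\<^sup>T *\<^sub>v r1) \<bullet> h"
    by (rule transpose_vec_mult_scalar[OF P h r1, symmetric])
  also have "\<dots> = c * ((Q\<^sup>T *\<^sub>v r2) \<bullet> h)"
    using normal Q h r2 by (simp add: defs(1,2)[symmetric] smult_scalar_prod_distrib[of _ k])
  also have "\<dots> = c * (r2 \<bullet> (Q *\<^sub>v h))"
    by (simp only: transpose_vec_mult_scalar[OF Q h r2])
  finally have orth: "r1 \<bullet> (P *\<^sub>v h) = c * (r2 \<bullet> (Q *\<^sub>v h))" .
  have "(l2norm (a - P *\<^sub>v v))\<^sup>2 = r1 \<bullet> r1 - 2 * (r1 \<bullet> (P *\<^sub>v h)) + (l2norm (P *\<^sub>v h))\<^sup>2"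
    unfolding e1 by (simp add: l2norm_power2 scalar_prod_add_smult_self[OF r1 Ph])
  moreover have "(l2norm (b + Q *\<^sub>v v))\<^sup>2 = r2 \<bullet> r2 + 2 * (r2 \<bullet> (Q *\<^sub>v h)) + (l2norm (Q *\<^sub>v h))\<^sup>2"
    unfolding e2 using scalar_prod_add_smult_self[OF r2 Qh, of 1] by (simp only: l2norm_power2) simp
  ultimately have "1 / 2 * (l2norm (a - P *\<^sub>v v))\<^sup>2 + c / 2 * (l2norm (b + Q *\<^sub>v v))\<^sup>2
    = 1 / 2 * (r1 \<bullet> r1) + c / 2 * (r2 \<bullet> r2)
      + (1 / 2 * (l2norm (P *\<^sub>v h))\<^sup>2 + c / 2 * (l2norm (Q *\<^sub>v h))\<^sup>2)"
    using orth by (simp add: algebra_simps)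
  moreover have "0 \<le> 1 / 2 * (l2norm (P *\<^sub>v h))\<^sup>2 + c / 2 * (l2norm (Q *\<^sub>v h))\<^sup>2"
    using c by simp
  ultimately show ?thesis
    unfolding defs(1,2)[symmetric] l2norm_power2[of r1] l2norm_power2[of r2] by linarith
qed

lemma weighted_gram_mult_vec:
  fixes P Q P' Q' :: "real mat"
  assumes "P \<in> carrier_mat n k" "Q \<in> carrier_mat e k" "P' \<in> carrier_mat n d" "Q' \<in> carrier_mat e d"
    and "v \<in> carrier_vec d"
  shows "(P\<^sup>T * P' + c \<cdot>\<^sub>m (Q\<^sup>T * Q')) *\<^sub>v v
    = P\<^sup>T *\<^sub>v (P' *\<^sub>v v) + c \<cdot>\<^sub>v (Q\<^sup>T *\<^sub>v (Q' *\<^sub>v v))"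
proof -
  have "(c \<cdot>\<^sub>m (Q\<^sup>T * Q')) *\<^sub>v v = c \<cdot>\<^sub>v ((Q\<^sup>T * Q') *\<^sub>v v)"
    by (rule smult_mat_mult_vec[of _ k d]) (use assms in simp_all)
  then show ?thesis
    using assms by (simp add: add_mult_distrib_mat_vec[of _ k d] assoc_mult_mat_vec[of _ k _ _ d])
qed

text \<open>Pairing the vanishing image with \<open>v\<close> gives a sum of two nonnegative terms, of which the first is
  the squared norm of \<open>P v\<close>. Hence \<open>P v\<close> is zero, and full column rank applies.\<close>
lemma weighted_gram_trivial_kernel:
  fixes P Q :: "real mat"
  assumes P: "P \<in> carrier_mat n k" and Q: "Q \<in> carrier_mat e k" and c: "0 \<le> c"
    and rank: "vec_space.rank n P = k"
    and v: "v \<in> carrier_vec k" "(P\<^sup>T * P + c \<cdot>\<^sub>m (Q\<^sup>T * Q)) *\<^sub>v v = 0\<^sub>v k"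
  shows "v = 0\<^sub>v k"
proof -
  have Pv: "P *\<^sub>v v \<in> carrier_vec n" and Qv: "Q *\<^sub>v v \<in> carrier_vec e"
    using P Q v(1) by simp_all
  have "0 = (P\<^sup>T *\<^sub>v (P *\<^sub>v v) + c \<cdot>\<^sub>v (Q\<^sup>T *\<^sub>v (Q *\<^sub>v v))) \<bullet> v"
    using v(2) unfolding weighted_gram_mult_vec[OF P Q P Q v(1)] using v(1) by simp
  also have "\<dots> = (P\<^sup>T *\<^sub>v (P *\<^sub>v v)) \<bullet> v + c * ((Q\<^sup>T *\<^sub>v (Q *\<^sub>v v)) \<bullet> v)"
    using P Q v(1) by (simp add: add_scalar_prod_distrib[of _ k] smult_scalar_prod_distrib[of _ k])
  also have "\<dots> = (l2norm (P *\<^sub>v v))\<^sup>2 + c * (l2norm (Q *\<^sub>v v))\<^sup>2"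
    unfolding transpose_vec_mult_scalar[OF P v(1) Pv] transpose_vec_mult_scalar[OF Q v(1) Qv]
    by (simp add: l2norm_power2)
  finally have "(l2norm (P *\<^sub>v v))\<^sup>2 \<le> 0"
    using c by (smt (verit) mult_nonneg_nonneg zero_le_power2)
  then have "L2_set (\<lambda>i. (P *\<^sub>v v) $ i) {..<n} = 0"
    using P by (simp add: l2norm_eq_L2_set)
  then have "P *\<^sub>v v = 0\<^sub>v n"
    using P by (intro eq_vecI) (auto simp: L2_set_eq_0_iff)
  then show ?thesis
    by (rule full_column_rank_imp_trivial_kernel[OF P rank v(1)])
qed

text \<open>The affine map defined by \<open>H1\<close> and \<open>H2\<close> is the solution of the normal equations for the second
  block of variables when the first block is held at \<open>\<beta>\<close>.\<close>
lemma ridge_partial_minimizer: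
  fixes P1 P2 Q1 Q2 :: "real mat"
  assumes P1: "P1 \<in> carrier_mat n d" and P2: "P2 \<in> carrier_mat n k"
    and Q1: "Q1 \<in> carrier_mat e d" and Q2: "Q2 \<in> carrier_mat e k"
    and c: "0 \<le> c" and rank: "vec_space.rank n P2 = k"
    and M: "M = P2\<^sup>T * P2 + c \<cdot>\<^sub>m (Q2\<^sup>T * Q2)"
    and H1: "H1 = mat_inv M * P2\<^sup>T"
    and H2: "H2 = mat_inv M * (P2\<^sup>T * P1 + c \<cdot>\<^sub>m (Q2\<^sup>T * Q1))"
    and y: "y \<in> carrier_vec n" and \<beta>: "\<beta> \<in> carrier_vec d"
    and v0: "v0 = H1 *\<^sub>v y - H2 *\<^sub>v \<beta>" and v: "v \<in> carrier_vec k"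
  shows "1 / 2 * (l2norm (y - P1 *\<^sub>v \<beta> - P2 *\<^sub>v v0))\<^sup>2 + c / 2 * (l2norm (Q1 *\<^sub>v \<beta> + Q2 *\<^sub>v v0))\<^sup>2
    \<le> 1 / 2 * (l2norm (y - P1 *\<^sub>v \<beta> - P2 *\<^sub>v v))\<^sup>2 + c / 2 * (l2norm (Q1 *\<^sub>v \<beta> + Q2 *\<^sub>v v))\<^sup>2"
proof -
  let ?R = "P2\<^sup>T * P1 + c \<cdot>\<^sub>m (Q2\<^sup>T * Q1)"
  have Mc: "M \<in> carrier_mat k k" and Rc: "?R \<in> carrier_mat k d"
    using P1 P2 Q1 Q2 by (simp_all add: M)
  have inv: "mat_inv M \<in> carrier_mat k k" "M * mat_inv M = 1\<^sub>m k"
    using mat_inv_of_trivial_kernel[OF Mc] weighted_gram_trivial_kernel[OF P2 Q2 c rank]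
    unfolding M by blast+
  have cancel: "M *\<^sub>v (mat_inv M *\<^sub>v u) = u" if "u \<in> carrier_vec k" for u
    using assoc_mult_mat_vec[OF Mc inv(1) that] inv(2) that by simp
  have P2y: "P2\<^sup>T *\<^sub>v y \<in> carrier_vec k" and R\<beta>: "?R *\<^sub>v \<beta> \<in> carrier_vec k"
    using P2 y Rc \<beta> by simp_all
  have v0_eq: "v0 = mat_inv M *\<^sub>v (P2\<^sup>T *\<^sub>v y) - mat_inv M *\<^sub>v (?R *\<^sub>v \<beta>)"
    unfolding v0 H1 H2
    using assoc_mult_mat_vec[OF inv(1) _ y, of "P2\<^sup>T"] assoc_mult_mat_vec[OF inv(1) Rc \<beta>] P2 by simp
  have v0c: "v0 \<in> carrier_vec k"
    unfolding v0_eq using inv(1) P2y R\<beta> by simp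
  have "M *\<^sub>v v0 = P2\<^sup>T *\<^sub>v y - ?R *\<^sub>v \<beta>"
    unfolding v0_eq using inv(1) P2y R\<beta>
    by (subst mult_minus_distrib_mat_vec[OF Mc]) (simp_all add: cancel)
  then have Mv0: "P2\<^sup>T *\<^sub>v (P2 *\<^sub>v v0) + c \<cdot>\<^sub>v (Q2\<^sup>T *\<^sub>v (Q2 *\<^sub>v v0))
      = P2\<^sup>T *\<^sub>v y - (P2\<^sup>T *\<^sub>v (P1 *\<^sub>v \<beta>) + c \<cdot>\<^sub>v (Q2\<^sup>T *\<^sub>v (Q1 *\<^sub>v \<beta>)))"
    unfolding M weighted_gram_mult_vec[OF P2 Q2 P2 Q2 v0c] weighted_gram_mult_vec[OF P2 Q2 P1 Q1 \<beta>] .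
  have normal: "P2\<^sup>T *\<^sub>v ((y - P1 *\<^sub>v \<beta>) - P2 *\<^sub>v v0) = c \<cdot>\<^sub>v (Q2\<^sup>T *\<^sub>v (Q1 *\<^sub>v \<beta> + Q2 *\<^sub>v v0))"
  proof -
    have P2T: "P2\<^sup>T \<in> carrier_mat k n" and Q2T: "Q2\<^sup>T \<in> carrier_mat k e"
      using P2 Q2 by simp_all
    have P1\<beta>: "P1 *\<^sub>v \<beta> \<in> carrier_vec n" and P2v0: "P2 *\<^sub>v v0 \<in> carrier_vec n"
      and Q1\<beta>: "Q1 *\<^sub>v \<beta> \<in> carrier_vec e" and Q2v0: "Q2 *\<^sub>v v0 \<in> carrier_vec e"
      using P1 P2 Q1 Q2 \<beta> v0c by simp_all
    show ?thesis
    proof (rule eq_vecI)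
      fix i assume "i < dim_vec (c \<cdot>\<^sub>v (Q2\<^sup>T *\<^sub>v (Q1 *\<^sub>v \<beta> + Q2 *\<^sub>v v0)))"
      then have i: "i < k"
        using Q2T by simp
      have l: "P2\<^sup>T *\<^sub>v ((y - P1 *\<^sub>v \<beta>) - P2 *\<^sub>v v0)
          = P2\<^sup>T *\<^sub>v y - P2\<^sup>T *\<^sub>v (P1 *\<^sub>v \<beta>) - P2\<^sup>T *\<^sub>v (P2 *\<^sub>v v0)"
        using mult_minus_distrib_mat_vec[OF P2T, of "y - P1 *\<^sub>v \<beta>" "P2 *\<^sub>v v0"]
          mult_minus_distrib_mat_vec[OF P2T y P1\<beta>] y P1\<beta> P2v0 by simp
      have r: "Q2\<^sup>T *\<^sub>v (Q1 *\<^sub>v \<beta> + Q2 *\<^sub>v v0) = Q2\<^sup>T *\<^sub>v (Q1 *\<^sub>v \<beta>) + Q2\<^sup>T *\<^sub>v (Q2 *\<^sub>v v0)"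
        by (rule mult_add_distrib_mat_vec[OF Q2T Q1\<beta> Q2v0])
      define p0 p1 p2 q1 q2 where d: "p0 = P2\<^sup>T *\<^sub>v y" "p1 = P2\<^sup>T *\<^sub>v (P1 *\<^sub>v \<beta>)"
        "p2 = P2\<^sup>T *\<^sub>v (P2 *\<^sub>v v0)" "q1 = Q2\<^sup>T *\<^sub>v (Q1 *\<^sub>v \<beta>)" "q2 = Q2\<^sup>T *\<^sub>v (Q2 *\<^sub>v v0)"
      have dims: "dim_vec p0 = k" "dim_vec p1 = k" "dim_vec p2 = k" "dim_vec q1 = k" "dim_vec q2 = k"
        using P2T Q2T by (simp_all add: d)
      have "(p2 + c \<cdot>\<^sub>v q2) $ i = (p0 - (p1 + c \<cdot>\<^sub>v q1)) $ i"
        using Mv0 by (simp add: d)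
      then have "(p0 - p1 - p2) $ i = (c \<cdot>\<^sub>v (q1 + q2)) $ i"
        using i dims by (simp add: distrib_left)
      then show "(P2\<^sup>T *\<^sub>v ((y - P1 *\<^sub>v \<beta>) - P2 *\<^sub>v v0)) $ i
          = (c \<cdot>\<^sub>v (Q2\<^sup>T *\<^sub>v (Q1 *\<^sub>v \<beta> + Q2 *\<^sub>v v0))) $ i"
        unfolding l r d .
    qed (use P2T Q2T in simp)
  qed
  show ?thesis
    by (rule normal_equations_imp_minimizer[OF P2 Q2 c _ _ v0c v normal]) (use P1 Q1 y \<beta> in simp_all)
qed

section \<open>Back to the original coordinates\<close>
lemma mult_mat_vec_append_split:
  fixes X :: "real mat"
  assumes X: "X \<in> carrier_mat r (d + k)" and u: "u \<in> carrier_vec d" and w: "w \<in> carrier_vec k"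
  shows "X *\<^sub>v (u @\<^sub>v w) = first_cols d X *\<^sub>v u + last_cols k X *\<^sub>v w"
proof (rule eq_vecI)
  fix i assume "i < dim_vec (first_cols d X *\<^sub>v u + last_cols k X *\<^sub>v w)"
  then have i: "i < r"
    using X by (simp add: last_cols_def)
  have Fc: "first_cols d X \<in> carrier_mat r d" and Lc: "last_cols k X \<in> carrier_mat r k"
    using X by (simp_all add: first_cols_def last_cols_def)
  have rF: "row (first_cols d X) i \<in> carrier_vec d" and rL: "row (last_cols k X) i \<in> carrier_vec k"
    using row_carrier[of "first_cols d X" i] row_carrier[of "last_cols k X" i] Fc Lc by simp_all
  have row_split: "row X i = row (first_cols d X) i @\<^sub>v row (last_cols k X) i"
  proof (rule eq_vecI)
    fix j assume "j < dim_vec (row (first_cols d X) i @\<^sub>v row (last_cols k X) i)"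
    then have j: "j < d + k"
      using Fc Lc by simp
    show "row X i $ j = (row (first_cols d X) i @\<^sub>v row (last_cols k X) i) $ j"
    proof (cases "j < d")
      case True
      then show ?thesis
        using X i j by (simp add: row_def first_cols_def last_cols_def)
    next
      case False
      then show ?thesis
        using X i j by (simp add: row_def first_cols_def last_cols_def)
    qed
  qed (use X Fc Lc in simp)
  have "(X *\<^sub>v (u @\<^sub>v w)) $ i = row X i \<bullet> (u @\<^sub>v w)"
    using X i by simp
  also have "\<dots> = row (first_cols d X) i \<bullet> u + row (last_cols k X) i \<bullet> w"
    unfolding row_split by (rule scalar_prod_append[OF rF rL u w])
  also have "\<dots> = (first_cols d X *\<^sub>v u + last_cols k X *\<^sub>v w) $ i"
    using Fc Lc i by simp
  finally show "(X *\<^sub>v (u @\<^sub>v w)) $ i = (first_cols d X *\<^sub>v u + last_cols k X *\<^sub>v w) $ i" .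
qed (use X in \<open>simp add: last_cols_def\<close>)

lemma diff_mat_carrier: "diff_mat N m \<in> carrier_mat (N - m) N"
  by (induction m) (auto simp: first_diff_mat_def)

lemma scaled_diff_mat_carrier: "1 \<le> l \<Longrightarrow> scaled_diff_mat l t q \<in> carrier_mat (l - 1) (l + q)"
  by (induction q) (auto simp: first_diff_mat_def scaled_first_diff_mat_def)

text \<open>Linear maps are Lipschitz, so \<open>P\<close> sends a small ball around \<open>\<alpha>\<close> into the neighbourhood on which
  \<open>F\<close> is minimal, and the minorant carries the inequality over to \<open>f\<close>. With \<open>F\<close> a partial
  minimum of \<open>f\<close> over the remaining variables, the minorant property holds by construction.\<close>
lemma local_min_lift:
  assumes P: "P \<in> carrier_mat d k" and \<alpha>: "\<alpha> \<in> carrier_vec k"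
    and minorant: "\<And>u. u \<in> carrier_vec k \<Longrightarrow> F (P *\<^sub>v u) \<le> f u"
    and touch: "f \<alpha> = F (P *\<^sub>v \<alpha>)"
    and min: "local_min d F (P *\<^sub>v \<alpha>)"
  shows "local_min k f \<alpha>"
proof -
  obtain \<epsilon> where \<epsilon>: "\<epsilon> > 0"
    and le: "\<And>u. u \<in> carrier_vec d \<Longrightarrow> l2norm (u - P *\<^sub>v \<alpha>) < \<epsilon> \<Longrightarrow> F (P *\<^sub>v \<alpha>) \<le> F u"
    using min by (auto simp: local_min_def)
  obtain C where C: "C > 0" "\<And>v. v \<in> carrier_vec k \<Longrightarrow> l2norm (P *\<^sub>v v) \<le> C * l2norm v"
    using l2norm_mult_mat_vec_bound[OF P, of thesis] by blast
  have "f \<alpha> \<le> f u" if u: "u \<in> carrier_vec k" "l2norm (u - \<alpha>) < \<epsilon> / C" for u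
  proof -
    have "l2norm (P *\<^sub>v u - P *\<^sub>v \<alpha>) = l2norm (P *\<^sub>v (u - \<alpha>))"
      using P \<alpha> u(1) by (simp add: mult_minus_distrib_mat_vec[of _ d k])
    also have "\<dots> \<le> C * l2norm (u - \<alpha>)"
      using C(2) \<alpha> u(1) by simp
    also have "\<dots> < \<epsilon>"
      using u(2) C(1) by (simp add: pos_less_divide_eq mult.commute)
    finally have "F (P *\<^sub>v \<alpha>) \<le> F (P *\<^sub>v u)"
      using le P u(1) by simp
    then show ?thesis
      using touch minorant[OF u(1)] by simp
  qed
  then show ?thesis
    using \<alpha> \<epsilon> C(1) by (auto simp: local_min_def intro!: exI[of _ "\<epsilon> / C"])
qed

theorem theorem3p1:
  fixes p l n m K :: nat
    and t :: "int \<Rightarrow> real"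
    and x y \<beta>s :: "real vec"
    and c \<gamma> :: real
    and A B D Dp Sigma S1 S2 M H1 H2 L1 L2 :: "real mat"
    and z1 z2 :: "real vec"
    and g :: "real vec \<Rightarrow> real vec"
    and F Obj :: "real vec \<Rightarrow> real"
  assumes "l \<ge> 2" and "n \<ge> 1" and "c \<ge> 0" and "\<gamma> > 0" and "K < l"
    and "1 \<le> m" and "m \<le> l + p - 1"
    and knots: "strict_mono_on {- int p..int (l + p)} t"
    and x: "x \<in> carrier_vec n" "\<forall>i<n. t 0 \<le> x $ i \<and> x $ i < t (int l)"
    and y: "y \<in> carrier_vec n"
    and B: "B = bspline_mat p l t x"
    and D: "D = diff_mat (l + p) m"
    and Dp: "Dp = scaled_diff_mat l t p"
    and A: "A \<in> carrier_mat (p + 1) (l + p)" "invertible_mat (Dp @\<^sub>r A)"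
    and Sigma: "Sigma = mat_inv (Dp @\<^sub>r A)"
    and S1: "S1 = first_cols (l - 1) Sigma"
    and S2: "S2 = last_cols (p + 1) Sigma"
    and full_column_rank: "vec_space.rank n (B * S2) = p + 1"
    and M: "M = (B * S2)\<^sup>T * (B * S2) + c \<cdot>\<^sub>m ((D * S2)\<^sup>T * (D * S2))"
    and H1: "H1 = mat_inv M * (B * S2)\<^sup>T"
    and H2: "H2 = mat_inv M * ((B * S2)\<^sup>T * (B * S1) + c \<cdot>\<^sub>m ((D * S2)\<^sup>T * (D * S1)))"
    and z1: "z1 = y - (B * S2 * H1) *\<^sub>v y"
    and z2: "z2 = (D * S2 * H1) *\<^sub>v y"
    and L1: "L1 = B * S1 - B * S2 * H2"
    and L2: "L2 = D * S2 * H2 - D * S1"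
    and g: "\<And>\<beta>. g \<beta> = H1 *\<^sub>v y - H2 *\<^sub>v \<beta>"
    and \<gamma>: "\<gamma> > Max ((\<lambda>j. l2norm (col L1 j) + sqrt c * l2norm (col L2 j)) ` {..<l - 1})
              * sqrt ((l2norm z1)\<^sup>2 + c * (l2norm z2)\<^sup>2)"
    and F: "\<And>\<beta>. F \<beta> = 1 / 2 * (l2norm (z1 - L1 *\<^sub>v \<beta>))\<^sup>2 + c / 2 * (l2norm (z2 - L2 *\<^sub>v \<beta>))\<^sup>2
              + \<gamma> * trimmed_l1 K \<beta>"
    and Obj: "\<And>\<alpha>. Obj \<alpha> = 1 / 2 * (l2norm (y - B *\<^sub>v \<alpha>))\<^sup>2 + c / 2 * (l2norm (D *\<^sub>v \<alpha>))\<^sup>2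
              + \<gamma> * trimmed_l1 K (Dp *\<^sub>v \<alpha>)"
    and "local_min (l - 1) F \<beta>s"
  shows "l0norm \<beta>s \<le> K
    \<and> local_min (l + p) Obj (Sigma *\<^sub>v (\<beta>s @\<^sub>v g \<beta>s))
    \<and> l0norm (Dp *\<^sub>v (Sigma *\<^sub>v (\<beta>s @\<^sub>v g \<beta>s))) \<le> K"
proof -
  define d k e where "d = l - 1" and "k = p + 1" and "e = l + p - m"
  have N: "l + p = d + k"
    using \<open>l \<ge> 2\<close> by (simp add: d_def k_def)
  have Bc: "B \<in> carrier_mat n (d + k)"
    using x(1) by (simp add: B bspline_mat_def N)
  have Dc: "D \<in> carrier_mat e (d + k)"
    using diff_mat_carrier[of "l + p" m] by (simp add: D e_def N)
  have Dpc: "Dp \<in> carrier_mat d (d + k)"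
    using scaled_diff_mat_carrier[of l t p] \<open>l \<ge> 2\<close> by (simp add: Dp d_def N)
  have Ac: "A \<in> carrier_mat k (d + k)"
    using A(1) by (simp add: k_def N)
  have Dhc: "Dp @\<^sub>r A \<in> carrier_mat (d + k) (d + k)"
    using Dpc Ac by (rule carrier_append_rows)
  note inv = mat_inv_of_invertible[OF Dhc A(2), folded Sigma]
  have S1c: "S1 \<in> carrier_mat (d + k) d" and S2c: "S2 \<in> carrier_mat (d + k) k"
    using inv(1) by (simp_all add: S1 S2 first_cols_def last_cols_def d_def k_def)
  define P1 P2 Q1 Q2 where "P1 = B * S1" and "P2 = B * S2" and "Q1 = D * S1" and "Q2 = D * S2"
  note P_defs = P1_def P2_def Q1_def Q2_def
  have P1: "P1 \<in> carrier_mat n d" and P2: "P2 \<in> carrier_mat n k"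
    and Q1: "Q1 \<in> carrier_mat e d" and Q2: "Q2 \<in> carrier_mat e k"
    using Bc Dc S1c S2c by (simp_all add: P_defs)
  note M' = M[folded P_defs] and H1' = H1[folded P_defs] and H2' = H2[folded P_defs]
  have rank: "vec_space.rank n P2 = k"
    using full_column_rank by (simp add: P2_def k_def)
  have Mc: "M \<in> carrier_mat k k"
    using P2 Q2 by (simp add: M')
  have Mi: "mat_inv M \<in> carrier_mat k k"
    using mat_inv_of_trivial_kernel(1)[OF Mc]
      weighted_gram_trivial_kernel[OF P2 Q2 \<open>c \<ge> 0\<close> rank, folded M'] by blast
  have H1c: "H1 \<in> carrier_mat k n" and H2c: "H2 \<in> carrier_mat k d"
    using Mi P1 P2 Q1 Q2 by (simp_all add: H1' H2')
  have gc: "g \<beta> \<in> carrier_vec k" if "\<beta> \<in> carrier_vec d" for \<beta>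
    using H1c H2c y that by (simp add: g)
  have L1c: "L1 \<in> carrier_mat n d" and L2c: "L2 \<in> carrier_mat e d"
    using P1 Q1 mult_carrier_mat[OF P2 H2c] mult_carrier_mat[OF Q2 H2c]
    unfolding L1 L2 P_defs[symmetric] by (blast intro: minus_carrier_mat)+
  have z1c: "z1 \<in> carrier_vec n" and z2c: "z2 \<in> carrier_vec e"
    using y mult_carrier_mat[OF P2 H1c] mult_carrier_mat[OF Q2 H1c]
    unfolding z1 z2 P_defs[symmetric] by (auto intro: mult_mat_vec_carrier)
  have \<beta>s: "\<beta>s \<in> carrier_vec d" and F_min: "local_min d F \<beta>s"
    using \<open>local_min (l - 1) F \<beta>s\<close> by (simp_all add: local_min_def d_def)

  have sparse: "l0norm \<beta>s \<le> K"
  proof (rule weighted_exact_penalty_sparsity[OF L1c L2c z1c z2c \<open>c \<ge> 0\<close> _ F F_min])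
    fix j assume "j < d"
    then have "l2norm (col L1 j) + sqrt c * l2norm (col L2 j)
        \<le> Max ((\<lambda>j. l2norm (col L1 j) + sqrt c * l2norm (col L2 j)) ` {..<l - 1})"
      by (intro Max_ge) (simp_all add: d_def)
    moreover have "0 \<le> sqrt ((l2norm z1)\<^sup>2 + c * (l2norm z2)\<^sup>2)"
      using \<open>c \<ge> 0\<close> by simp
    ultimately have "(l2norm (col L1 j) + sqrt c * l2norm (col L2 j))
        * sqrt ((l2norm z1)\<^sup>2 + c * (l2norm z2)\<^sup>2)
      \<le> Max ((\<lambda>j. l2norm (col L1 j) + sqrt c * l2norm (col L2 j)) ` {..<l - 1})
        * sqrt ((l2norm z1)\<^sup>2 + c * (l2norm z2)\<^sup>2)"
      by (rule mult_right_mono)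
    then show "(l2norm (col L1 j) + sqrt c * l2norm (col L2 j))
        * sqrt ((l2norm z1)\<^sup>2 + c * (l2norm z2)\<^sup>2) < \<gamma>"
      using \<gamma> by linarith
  qed

  \<comment> \<open>The objective in the coordinates given by the change of variables.\<close>
  define J where "J \<beta> v = 1 / 2 * (l2norm (y - P1 *\<^sub>v \<beta> - P2 *\<^sub>v v))\<^sup>2
    + c / 2 * (l2norm (Q1 *\<^sub>v \<beta> + Q2 *\<^sub>v v))\<^sup>2 + \<gamma> * trimmed_l1 K \<beta>" for \<beta> v

  have F_eq: "F \<beta> = J \<beta> (g \<beta>)" if \<beta>: "\<beta> \<in> carrier_vec d" for \<beta>
  proof -
    have H1y: "H1 *\<^sub>v y \<in> carrier_vec k" and H2\<beta>: "H2 *\<^sub>v \<beta> \<in> carrier_vec k"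
      using H1c H2c y \<beta> by simp_all
    have Pg: "P2 *\<^sub>v g \<beta> = P2 *\<^sub>v (H1 *\<^sub>v y) - P2 *\<^sub>v (H2 *\<^sub>v \<beta>)"
      unfolding g by (rule mult_minus_distrib_mat_vec[OF P2 H1y H2\<beta>])
    have Qg: "Q2 *\<^sub>v g \<beta> = Q2 *\<^sub>v (H1 *\<^sub>v y) - Q2 *\<^sub>v (H2 *\<^sub>v \<beta>)"
      unfolding g by (rule mult_minus_distrib_mat_vec[OF Q2 H1y H2\<beta>])
    have z1_eq: "z1 = y - P2 *\<^sub>v (H1 *\<^sub>v y)"
      unfolding z1 P_defs[symmetric] using assoc_mult_mat_vec[OF P2 H1c y] by simp
    have z2_eq: "z2 = Q2 *\<^sub>v (H1 *\<^sub>v y)"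
      unfolding z2 P_defs[symmetric] using assoc_mult_mat_vec[OF Q2 H1c y] by simp
    have L1_eq: "L1 *\<^sub>v \<beta> = P1 *\<^sub>v \<beta> - P2 *\<^sub>v (H2 *\<^sub>v \<beta>)"
      unfolding L1 P_defs[symmetric] minus_mult_distrib_mat_vec[OF P1 mult_carrier_mat[OF P2 H2c] \<beta>]
        assoc_mult_mat_vec[OF P2 H2c \<beta>] ..
    have L2_eq: "L2 *\<^sub>v \<beta> = Q2 *\<^sub>v (H2 *\<^sub>v \<beta>) - Q1 *\<^sub>v \<beta>"
      unfolding L2 P_defs[symmetric] minus_mult_distrib_mat_vec[OF mult_carrier_mat[OF Q2 H2c] Q1 \<beta>]
        assoc_mult_mat_vec[OF Q2 H2c \<beta>] ..
    have "z1 - L1 *\<^sub>v \<beta> = y - P1 *\<^sub>v \<beta> - P2 *\<^sub>v g \<beta>"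
      unfolding z1_eq L1_eq Pg using P1 P2 y
      by (intro eq_vecI) (simp_all del: index_mult_mat_vec)
    moreover have "z2 - L2 *\<^sub>v \<beta> = Q1 *\<^sub>v \<beta> + Q2 *\<^sub>v g \<beta>"
      unfolding z2_eq L2_eq Qg using Q1 Q2
      by (intro eq_vecI) (simp_all del: index_mult_mat_vec)
    ultimately show ?thesis
      by (simp add: F J_def)
  qed

  \<comment> \<open>Hence F is the partial minimum of the objective over the second block of variables.\<close>
  have J_min: "J \<beta> (g \<beta>) \<le> J \<beta> v" if "\<beta> \<in> carrier_vec d" "v \<in> carrier_vec k" for \<beta> v
    using ridge_partial_minimizer[OF P1 P2 Q1 Q2 \<open>c \<ge> 0\<close> rank M' H1' H2' y that(1) g that(2)]
    by (simp add: J_def)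

  have Dp_Sigma: "Dp *\<^sub>v (Sigma *\<^sub>v (\<beta> @\<^sub>v v)) = \<beta>"
    if "\<beta> \<in> carrier_vec d" "v \<in> carrier_vec k" for \<beta> v
  proof -
    have w: "\<beta> @\<^sub>v v \<in> carrier_vec (d + k)"
      using that by simp
    have Sw: "Sigma *\<^sub>v (\<beta> @\<^sub>v v) \<in> carrier_vec (d + k)"
      using inv(1) w by simp
    have "(Dp @\<^sub>r A) *\<^sub>v (Sigma *\<^sub>v (\<beta> @\<^sub>v v)) = \<beta> @\<^sub>v v"
      using assoc_mult_mat_vec[OF Dhc inv(1) w] inv(2) w by simp
    then have "(Dp *\<^sub>v (Sigma *\<^sub>v (\<beta> @\<^sub>v v))) @\<^sub>v (A *\<^sub>v (Sigma *\<^sub>v (\<beta> @\<^sub>v v))) = \<beta> @\<^sub>v v"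
      unfolding mat_mult_append[OF Dpc Ac Sw] .
    moreover have "Dp *\<^sub>v (Sigma *\<^sub>v (\<beta> @\<^sub>v v)) \<in> carrier_vec d"
      using Dpc Sw by simp
    ultimately show ?thesis
      using append_vec_eq that(1) by blast
  qed

  have Obj_Sigma: "Obj (Sigma *\<^sub>v (\<beta> @\<^sub>v v)) = J \<beta> v"
    if \<beta>: "\<beta> \<in> carrier_vec d" and v: "v \<in> carrier_vec k" for \<beta> v
  proof -
    have split: "Sigma *\<^sub>v (\<beta> @\<^sub>v v) = S1 *\<^sub>v \<beta> + S2 *\<^sub>v v"
      using mult_mat_vec_append_split[OF inv(1) \<beta> v] by (simp add: S1 S2 d_def k_def)
    have S\<beta>: "S1 *\<^sub>v \<beta> \<in> carrier_vec (d + k)" and Sv: "S2 *\<^sub>v v \<in> carrier_vec (d + k)"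
      using S1c S2c \<beta> v by simp_all
    have "B *\<^sub>v (Sigma *\<^sub>v (\<beta> @\<^sub>v v)) = P1 *\<^sub>v \<beta> + P2 *\<^sub>v v"
      unfolding split mult_add_distrib_mat_vec[OF Bc S\<beta> Sv] P_defs
        assoc_mult_mat_vec[OF Bc S1c \<beta>] assoc_mult_mat_vec[OF Bc S2c v] ..
    then have "y - B *\<^sub>v (Sigma *\<^sub>v (\<beta> @\<^sub>v v)) = y - P1 *\<^sub>v \<beta> - P2 *\<^sub>v v"
      using P1 P2 y by (intro eq_vecI) (simp_all del: index_mult_mat_vec)
    moreover have "D *\<^sub>v (Sigma *\<^sub>v (\<beta> @\<^sub>v v)) = Q1 *\<^sub>v \<beta> + Q2 *\<^sub>v v"
      unfolding split mult_add_distrib_mat_vec[OF Dc S\<beta> Sv] P_defs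
        assoc_mult_mat_vec[OF Dc S1c \<beta>] assoc_mult_mat_vec[OF Dc S2c v] ..
    ultimately show ?thesis
      unfolding Obj Dp_Sigma[OF that] J_def by simp
  qed

  let ?\<alpha> = "Sigma *\<^sub>v (\<beta>s @\<^sub>v g \<beta>s)"
  have Dp_\<alpha>: "Dp *\<^sub>v ?\<alpha> = \<beta>s"
    by (rule Dp_Sigma[OF \<beta>s gc[OF \<beta>s]])
  have "local_min (d + k) Obj ?\<alpha>"
  proof (rule local_min_lift[OF Dpc])
    show "?\<alpha> \<in> carrier_vec (d + k)"
      using inv(1) \<beta>s gc[OF \<beta>s] by simp
    show "Obj ?\<alpha> = F (Dp *\<^sub>v ?\<alpha>)"
      unfolding Dp_\<alpha> Obj_Sigma[OF \<beta>s gc[OF \<beta>s]] F_eq[OF \<beta>s] ..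
    show "local_min d F (Dp *\<^sub>v ?\<alpha>)"
      unfolding Dp_\<alpha> by (rule F_min)
    fix u :: "real vec" assume u: "u \<in> carrier_vec (d + k)"
    have Dpu: "Dp *\<^sub>v u \<in> carrier_vec d" and Au: "A *\<^sub>v u \<in> carrier_vec k"
      using Dpc Ac u by simp_all
    have "Sigma *\<^sub>v ((Dp *\<^sub>v u) @\<^sub>v (A *\<^sub>v u)) = u"
      using assoc_mult_mat_vec[OF inv(1) Dhc u] inv(3) u unfolding mat_mult_append[OF Dpc Ac u] by simp
    then have "Obj u = J (Dp *\<^sub>v u) (A *\<^sub>v u)"
      using Obj_Sigma[OF Dpu Au] by simp
    then show "F (Dp *\<^sub>v u) \<le> Obj u"
      using F_eq[OF Dpu] J_min[OF Dpu Au] by simp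
  qed
  then show ?thesis
    using sparse by (simp add: Dp_\<alpha> N)
qed

end
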